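(* Let $k\geq 2$ be an integer and let $\mathscr{S}^k$ be the set of gap-frequency partitions in which each part appears at most $k$ times. Then, as formal power series in $x_1,\dots,x_k,q$, $$\sum_{\lambda\in\mathscr{S}^k}x_1^{\ell(\lambda)}\Big(\prod_{i=2}^k x_i^{\ell_i(\lambda)}\Big)q^{|\lambda|}=\sum_{n_1,\dots,n_k\geq 0}\frac{x_1^{\sum_{i=1}^k i n_i}\Big(\prod_{i=2}^k x_i^{n_i}\Big)q^{\sum_{i=1}^k\left(i^2\binom{n_i}{2}+i n_i\right)+\sum_{1\leq i<j\leq k} ij\,n_in_j}}{(q;q)_{n_1}(q^2;q^2)_{n_2}\cdots(q^k;q^k)_{n_k}}.$$
   Context: A partition $\lambda$ is a finite non-decreasing sequence of positive integers (its parts), the empty partition being allowed; $|\lambda|$ is the sum of its parts and $\ell(\lambda)$ is the number of its parts counted with multiplicity. For $i\geq 2$, $\ell_i(\lambda)$ is the number of parts repeated exactly $i$ times, i.e. the number of distinct integers $a$ that occur exactly $i$ times as a part of $\lambda$ (so e.g. $\ell_2(1+1)=1$). A partition is a gap-frequency partition if, whenever a part $a$ appears exactly $i$ times (with $i\ge 1$), the next strictly larger part (if any) is at least $a+i$, and if that next larger part is exactly $a+i$ then it appears at most $i$ times. For $n\ge 0$, $(A;q)_n=\prod_{j=0}^{n-1}(1-Aq^j)$; thus $(q^m;q^m)_n=\prod_{j=1}^{n}(1-q^{mj})$. *)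

theory Defs
  imports
    "HOL-Analysis.Analysis"
    "HOL-Library.FuncSet"
    "HOL-Library.Poly_Mapping"
    "HOL-Computational_Algebra.Formal_Power_Series"
begin

definition is_partition :: "nat list \<Rightarrow> bool" where
  "is_partition p \<longleftrightarrow> sorted p \<and> (\<forall>a\<in>set p. a > 0)"

text \<open>The number of distinct integers that occur exactly \<open>i\<close> times as a part. It is only
  meaningful for \<open>i \<ge> 1\<close>, and only used for \<open>i \<ge> 2\<close>.\<close>

definition parts_repeated :: "nat \<Rightarrow> nat list \<Rightarrow> nat" where
  "parts_repeated i p = card {a. count_list p a = i}"

definition next_larger_part :: "nat list \<Rightarrow> nat \<Rightarrow> nat \<Rightarrow> bool" where
  "next_larger_part p a b \<longleftrightarrow> b \<in> set p \<and> a < b \<and> (\<forall>c\<in>set p. a < c \<longrightarrow> b \<le> c)"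

definition gap_frequency :: "nat list \<Rightarrow> bool" where
  "gap_frequency p \<longleftrightarrow> is_partition p \<and>
     (\<forall>a\<in>set p. \<forall>b. next_larger_part p a b \<longrightarrow>
        b \<ge> a + count_list p a \<and>
        (b = a + count_list p a \<longrightarrow> count_list p b \<le> count_list p a))"

definition gap_frequency_upto :: "nat \<Rightarrow> nat list set" where
  "gap_frequency_upto k = {p. gap_frequency p \<and> (\<forall>a. count_list p a \<le> k)}"

text \<open>
  Formal power series in \<open>q\<close> whose coefficients are polynomials over the integers in the
  indeterminates \<open>x\<^sub>0, x\<^sub>1, \<dots>\<close>, that is, finitely supported functions on finitely
  supported exponent vectors. This is a subring of the formal power series in all of the
  indeterminates. Convergence is that of the metric on type \<open>fps\<close>: for each \<open>N\<close>, the coefficient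
  of \<open>q\<^sup>N\<close> is eventually constant as an element of the polynomial ring.
\<close>

type_synonym xq_series = "((nat \<Rightarrow>\<^sub>0 nat) \<Rightarrow>\<^sub>0 int) fps"

definition x_var :: "nat \<Rightarrow> xq_series" where
  "x_var i = fps_const (Poly_Mapping.single (Poly_Mapping.single i 1) 1)"

definition q_var :: xq_series where
  "q_var = fps_X"

definition q_pochhammer :: "'a::comm_ring_1 \<Rightarrow> 'a \<Rightarrow> nat \<Rightarrow> 'a" where
  "q_pochhammer A q n = (\<Prod>j<n. 1 - A * q ^ j)"

definition partition_term :: "nat \<Rightarrow> nat list \<Rightarrow> xq_series" where
  "partition_term k p =
     x_var 1 ^ length p * (\<Prod>i=2..k. x_var i ^ parts_repeated i p) * q_var ^ sum_list p"

definition series_numerator :: "nat \<Rightarrow> (nat \<Rightarrow> nat) \<Rightarrow> xq_series" where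
  "series_numerator k n =
     x_var 1 ^ (\<Sum>i=1..k. i * n i) * (\<Prod>i=2..k. x_var i ^ n i) *
     q_var ^ ((\<Sum>i=1..k. i\<^sup>2 * (n i choose 2) + i * n i) +
              (\<Sum>i=1..k. \<Sum>j=i+1..k. i * j * n i * n j))"

definition series_denominator :: "nat \<Rightarrow> (nat \<Rightarrow> nat) \<Rightarrow> xq_series" where
  "series_denominator k n = (\<Prod>i=1..k. q_pochhammer (q_var ^ i) (q_var ^ i) (n i))"

text \<open>The coefficient ring has no \<open>inverse\<close> operation, so division of power series is not
  available. The denominator has constant coefficient 1, hence is a unit, and
  \<open>fps_right_inverse f y\<close> is the inverse of \<open>f\<close> whenever \<open>y\<close> is an inverse of the constant
  coefficient of \<open>f\<close>.\<close>

definition series_term :: "nat \<Rightarrow> (nat \<Rightarrow> nat) \<Rightarrow> xq_series" where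
  "series_term k n = series_numerator k n * fps_right_inverse (series_denominator k n) 1"

lemma series_denominator_nth_0: "fps_nth (series_denominator k n) 0 = 1"
proof -
  have prod0: "fps_nth (prod f A) 0 = (\<Prod>a\<in>A. fps_nth (f a) 0)" for f :: "nat \<Rightarrow> xq_series" and A
    by (induction A rule: infinite_finite_induct) auto
  have "fps_nth (q_pochhammer (q_var ^ i) (q_var ^ i) m :: xq_series) 0 = 1" if "i \<ge> 1" for i m
    unfolding q_pochhammer_def prod0 q_var_def using that
    by (intro prod.neutral) (auto simp: fps_X_power_nth)
  then show ?thesis
    unfolding series_denominator_def prod0 by (intro prod.neutral) auto
qed

lemma series_term_mult_denominator:
  "series_term k n * series_denominator k n = series_numerator k n"
proof -
  have "series_denominator k n * fps_right_inverse (series_denominator k n) 1 = 1"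
    by (rule fps_right_inverse) (simp add: series_denominator_nth_0)
  then show ?thesis
    unfolding series_term_def by (metis mult.assoc mult.commute mult.right_neutral)
qed

end

theory Submission
  imports Defs "HOL-Library.Multiset"
begin

text \<open>
  Let the distinct parts of a gap-frequency partition be \<open>a\<^sub>1 < \<dots> < a\<^sub>m\<close>, with multiplicities
  \<open>i\<^sub>1, \<dots>, i\<^sub>m\<close>, and put \<open>b\<^sub>j = a\<^sub>j - 1 - (i\<^sub>1 + \<dots> + i\<^bsub>j-1\<^esub>)\<close>. The gap condition says precisely that
  the pairs \<open>(b\<^sub>j, i\<^sub>j)\<close> are sorted by increasing \<open>b\<close> and, among equal \<open>b\<close>, by decreasing \<open>i\<close>. Hence
  gap-frequency partitions correspond to arbitrary multisets of pairs \<open>(b, i)\<close> with \<open>b \<ge> 0\<close> and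
  \<open>1 \<le> i \<le> k\<close>. If \<open>n\<^sub>i\<close> of the pairs have second component \<open>i\<close>, the size of the partition is the sum of
  the \<open>i b\<close> plus the exponent of \<open>q\<close> in the numerator, since
  \<open>\<Sum>\<^sub>l\<^sub><\<^sub>j i\<^sub>l i\<^sub>j\<close> does not depend on the order of the \<open>i\<^sub>j\<close>. For each \<open>i\<close>, the multisets of
  \<open>n\<^sub>i\<close> values \<open>b\<close> have generating function \<open>1 / (q\<^sup>i; q\<^sup>i)\<^bsub>n\<^sub>i\<^esub>\<close>.
\<close>

subsection \<open>Generating functions of weighted multisets\<close>

text \<open>An infinite fibre has \<open>card\<close> 0, which is why sums and products below assume
  finite fibres.\<close>

definition counting_fps :: "'b set \<Rightarrow> ('b \<Rightarrow> nat) \<Rightarrow> 'a::comm_ring_1 fps" where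
  "counting_fps A w = Abs_fps (\<lambda>N. of_nat (card {x\<in>A. w x = N}))"

lemma counting_fps_bij_betw:
  assumes "bij_betw h A B" "\<And>x. x \<in> A \<Longrightarrow> w' (h x) = w x"
  shows "counting_fps B w' = counting_fps A w"
proof -
  have "bij_betw h {x\<in>A. w x = N} {y\<in>B. w' y = N}" for N
    using assms by (auto simp: bij_betw_def inj_on_def)
  then have "card {x\<in>A. w x = N} = card {y\<in>B. w' y = N}" for N
    by (rule bij_betw_same_card)
  then show ?thesis
    unfolding counting_fps_def by simp
qed

lemma counting_fps_Un:
  assumes "A \<inter> B = {}" "\<And>N. finite {x\<in>A. w x = N}" "\<And>N. finite {x\<in>B. w x = N}"
  shows "counting_fps (A \<union> B) w = counting_fps A w + counting_fps B w"
proof -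
  have "{x\<in>A \<union> B. w x = N} = {x\<in>A. w x = N} \<union> {x\<in>B. w x = N}" for N by auto
  then have "card {x\<in>A \<union> B. w x = N} = card {x\<in>A. w x = N} + card {x\<in>B. w x = N}" for N
    using assms by (simp, intro card_Un_disjoint) auto
  then show ?thesis
    unfolding counting_fps_def by (simp add: fps_eq_iff)
qed

lemma counting_fps_shift:
  "counting_fps A (\<lambda>x. e + w x) = fps_X ^ e * counting_fps A w"
proof -
  have "{x\<in>A. e + w x = N} = (if N < e then {} else {x\<in>A. w x = N - e})" for N
    by auto
  then show ?thesis
    unfolding counting_fps_def by (auto simp: fps_eq_iff fps_X_power_mult_nth)
qed

lemma counting_fps_Times:
  assumes "\<And>N. finite {x\<in>A. v x = N}" "\<And>N. finite {y\<in>B. w y = N}"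
  shows "counting_fps (A \<times> B) (\<lambda>(x, y). v x + w y) = counting_fps A v * counting_fps B w"
proof -
  have "card {z\<in>A \<times> B. (case z of (x, y) \<Rightarrow> v x + w y) = N} =
        (\<Sum>i=0..N. card {x\<in>A. v x = i} * card {y\<in>B. w y = N - i})" for N
  proof -
    have "{z\<in>A \<times> B. (case z of (x, y) \<Rightarrow> v x + w y) = N} =
          (\<Union>i\<in>{0..N}. {x\<in>A. v x = i} \<times> {y\<in>B. w y = N - i})"
      by auto
    also have "card \<dots> = (\<Sum>i\<in>{0..N}. card ({x\<in>A. v x = i} \<times> {y\<in>B. w y = N - i}))"
      using assms by (intro card_UN_disjoint) auto
    finally show ?thesis
      by (simp add: card_cartesian_product)
  qed
  then show ?thesis
    unfolding counting_fps_def by (simp add: fps_eq_iff fps_mult_nth)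
qed

lemma finite_Times_weight:
  assumes "\<And>N. finite {x\<in>A. v x = N}" "\<And>N. finite {y\<in>B. w y = N}"
  shows "finite {z\<in>A \<times> B. (case z of (x, y) \<Rightarrow> v x + w y) = (N::nat)}"
proof -
  have "{z\<in>A \<times> B. (case z of (x, y) \<Rightarrow> v x + w y) = N} =
        (\<Union>i\<in>{0..N}. {x\<in>A. v x = i} \<times> {y\<in>B. w y = N - i})"
    by auto
  then show ?thesis using assms by simp
qed

section \<open>Multisets of fixed size\<close>

lemma finite_mset_size_eq:
  assumes "finite A"
  shows "finite {M. set_mset M \<subseteq> A \<and> size M = n}"
proof -
  have "{M. set_mset M \<subseteq> A \<and> size M = n} \<subseteq> mset ` {xs. set xs \<subseteq> A \<and> length xs = n}"
  proof
    fix M assume M: "M \<in> {M. set_mset M \<subseteq> A \<and> size M = n}"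
    obtain xs where "M = mset xs" using ex_mset by metis
    with M show "M \<in> mset ` {xs. set xs \<subseteq> A \<and> length xs = n}" by auto
  qed
  then show ?thesis
    by (rule finite_surj[OF finite_lists_length_eq[OF assms]])
qed

lemma finite_mset_sum_eq:
  assumes "i \<ge> (1::nat)"
  shows "finite {B \<in> {B. size B = m}. i * sum_mset B = N}"
proof (rule finite_subset)
  show "{B \<in> {B. size B = m}. i * sum_mset B = N} \<subseteq> {B. set_mset B \<subseteq> {..N} \<and> size B = m}"
  proof safe
    fix B b assume "b \<in># B" "N = i * sum_mset B"
    then have "b \<le> sum_mset B"
      by (simp add: sum_mset.remove)
    also have "\<dots> \<le> i * sum_mset B"
      using assms by simp
    finally show "b \<le> i * sum_mset B" .
  qed
qed (simp add: finite_mset_size_eq)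

text \<open>This yields the last factor of the q-Pochhammer symbol: incrementing all
  \<open>Suc m\<close> elements raises the weight by \<open>i * Suc m\<close>.\<close>

lemma counting_fps_mset_Suc:
  fixes m :: nat
  assumes "i \<ge> 1"
  shows "counting_fps {B. size B = Suc m} (\<lambda>B. i * sum_mset B) * (1 - fps_X ^ (i * Suc m)) =
         (counting_fps {B. size B = m} (\<lambda>B. i * sum_mset B) :: 'a::comm_ring_1 fps)"
proof -
  let ?P = "\<lambda>m. {B. size B = m} :: nat multiset set"
  let ?w = "\<lambda>B. i * sum_mset B"
  \<comment> \<open>either 0 is an element, or all elements can be decreased by 1\<close>
  let ?Z = "add_mset 0 ` ?P m" and ?S = "image_mset Suc ` ?P (Suc m)"
  have split: "?P (Suc m) = ?Z \<union> ?S"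
  proof safe
    fix B :: "nat multiset"
    assume B: "size B = Suc m" "B \<notin> ?S"
    have "0 \<in># B"
    proof (rule ccontr)
      assume "0 \<notin># B"
      \<comment> \<open>The truncated subtraction is undone by \<open>Suc\<close> because every
        element is positive.\<close>
      then have "image_mset Suc (image_mset (\<lambda>b. b - 1) B) = B"
        by (subst multiset.map_comp, intro multiset.map_ident_strong)
           (metis One_nat_def Suc_pred comp_apply gr0I)
      then have "B \<in> ?S"
        using B(1) by (metis (mono_tags, lifting) imageI mem_Collect_eq size_image_mset)
      then show False using B(2) by simp
    qed
    then obtain B' where "B = add_mset 0 B'" by (meson mset_add)
    then show "B \<in> ?Z" using B(1) by auto
  qed auto
  have sub: "?Z \<subseteq> ?P (Suc m)" "?S \<subseteq> ?P (Suc m)"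
    by auto
  have disj: "?Z \<inter> ?S = {}"
  proof -
    have "0 \<in># B" if "B \<in> ?Z" for B using that by auto
    moreover have "0 \<notin># B" if "B \<in> ?S" for B using that by auto
    ultimately show ?thesis by blast
  qed
  have fin: "finite {B\<in>C. ?w B = N}" if "C \<subseteq> ?P (Suc m)" for C N
    by (rule finite_subset[OF _ finite_mset_sum_eq[OF assms, of "Suc m" N]]) (use that in auto)
  have "bij_betw (add_mset 0) (?P m) ?Z"
    by (auto simp: bij_betw_def inj_on_def)
  then have Z: "counting_fps ?Z ?w = (counting_fps (?P m) ?w :: 'a fps)"
    by (rule counting_fps_bij_betw) auto
  have sum_Suc: "sum_mset (image_mset Suc B) = size B + sum_mset B" for B
    by (induction B) auto
  have "bij_betw (image_mset Suc) (?P (Suc m)) ?S"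
    using inj_on_subset[OF multiset.inj_map[OF inj_Suc]] by (simp add: bij_betw_def)
  then have "counting_fps ?S ?w = (counting_fps (?P (Suc m)) (\<lambda>B. i * Suc m + ?w B) :: 'a fps)"
    by (rule counting_fps_bij_betw) (auto simp: sum_Suc algebra_simps)
  also have "\<dots> = fps_X ^ (i * Suc m) * counting_fps (?P (Suc m)) ?w"
    by (rule counting_fps_shift)
  finally have S: "counting_fps ?S ?w = fps_X ^ (i * Suc m) * (counting_fps (?P (Suc m)) ?w :: 'a fps)" .
  have "counting_fps (?P (Suc m)) ?w = (counting_fps ?Z ?w + counting_fps ?S ?w :: 'a fps)"
    by (subst split) (rule counting_fps_Un[OF disj fin[OF sub(1)] fin[OF sub(2)]])
  then have "(counting_fps (?P (Suc m)) ?w :: 'a fps) =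
      counting_fps (?P m) ?w + fps_X ^ (i * Suc m) * counting_fps (?P (Suc m)) ?w"
    by (simp only: Z S)
  then show ?thesis
    by (simp add: algebra_simps)
qed

text \<open>Induction removes one factor at a time, down to the empty multiset. A product equal to 1
  expresses the reciprocal over any commutative ring.\<close>

lemma counting_fps_mset_mult_pochhammer:
  assumes "i \<ge> 1"
  shows "counting_fps {B. size B = m} (\<lambda>B. i * sum_mset B) *
         q_pochhammer (fps_X ^ i) (fps_X ^ i) m = (1 :: 'a::comm_ring_1 fps)"
proof (induction m)
  case 0
  have "{x::nat multiset. x = {#} \<and> i * sum_mset x = N} = (if N = 0 then {{#}} else {})" for N
    by auto
  then have "card {x::nat multiset. x = {#} \<and> i * sum_mset x = N} = (if N = 0 then 1 else 0)" for N
    by simp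
  then show ?case
    by (simp add: counting_fps_def q_pochhammer_def fps_eq_iff)
next
  case (Suc m)
  have "q_pochhammer (fps_X ^ i) (fps_X ^ i) (Suc m) =
        (1 - fps_X ^ (i * Suc m)) * (q_pochhammer (fps_X ^ i) (fps_X ^ i) m :: 'a fps)"
    by (simp add: q_pochhammer_def power_add power_mult mult.commute)
  then show ?case
    using Suc counting_fps_mset_Suc[OF assms, of m, where ?'a = 'a] by (simp only: mult.assoc[symmetric])
qed

section \<open>Multisets of coloured pairs\<close>

definition coloured_msets :: "nat set \<Rightarrow> (nat \<Rightarrow> nat) \<Rightarrow> (nat \<times> nat) multiset set" where
  "coloured_msets I n = {M. snd ` set_mset M \<subseteq> I \<and> (\<forall>i\<in>I. count (image_mset snd M) i = n i)}"

abbreviation weight :: "(nat \<times> nat) multiset \<Rightarrow> nat" where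
  "weight M \<equiv> (\<Sum>(b, i)\<in>#M. i * b)"

text \<open>The second component of a pair is its colour. Pairs of the new colour \<open>i\<close>
  are determined by their first components, and \<open>M\<close> contains none of them, so filtering
  by colour recovers both factors.\<close>

lemma coloured_msets_insert:
  assumes "i \<notin> I"
  shows "bij_betw (\<lambda>(B, M). image_mset (\<lambda>b. (b, i)) B + M)
           ({B. size B = n i} \<times> coloured_msets I n) (coloured_msets (insert i I) n)"
proof (rule bij_betwI[where g = "\<lambda>M. (image_mset fst {#x\<in>#M. snd x = i#}, {#x\<in>#M. snd x \<noteq> i#})"])
  let ?f = "\<lambda>(B, M). image_mset (\<lambda>b. (b, i)) B + M"
  let ?P = "{B. size B = n i} :: nat multiset set"
  let ?g = "\<lambda>M. (image_mset fst {#x\<in>#M. snd x = i#}, {#x\<in>#M. snd x \<noteq> i#})"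
  have c: "count (image_mset snd M) j = size {#x\<in>#M. snd x = j#}" for M :: "(nat \<times> nat) multiset" and j
    by (induction M) auto
  show "?f \<in> ?P \<times> coloured_msets I n \<rightarrow> coloured_msets (insert i I) n"
  proof
    fix x assume "x \<in> ?P \<times> coloured_msets I n"
    then obtain B M where x: "x = (B, M)" and B: "size B = n i" and M: "M \<in> coloured_msets I n"
      by auto
    have "i \<notin># image_mset snd M" using M assms by (auto simp: coloured_msets_def)
    then have "count (image_mset snd M) i = 0" by (simp only: not_in_iff)
    moreover have "count (image_mset (\<lambda>x. i) B) j = (if i = j then size B else 0)" for j
      by (simp add: image_mset_const_eq)
    ultimately show "?f x \<in> coloured_msets (insert i I) n"
      using M B assms by (auto simp: x coloured_msets_def multiset.map_comp o_def)
  qed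
  show "?g \<in> coloured_msets (insert i I) n \<rightarrow> ?P \<times> coloured_msets I n"
  proof
    fix M assume M: "M \<in> coloured_msets (insert i I) n"
    have "{#x\<in>#{#x\<in>#M. snd x \<noteq> i#}. snd x = j#} = {#x\<in>#M. snd x = j#}" if "j \<in> I" for j
      unfolding filter_filter_mset using that assms by (intro filter_mset_cong) auto
    then show "?g M \<in> ?P \<times> coloured_msets I n"
      using M by (auto simp: coloured_msets_def c simp del: filter_filter_mset)
  qed
  show "?g (?f x) = x" if "x \<in> ?P \<times> coloured_msets I n" for x
  proof -
    obtain B M where x: "x = (B, M)" by force
    have "\<forall>y\<in>#M. snd y \<noteq> i" using that x assms by (auto simp: coloured_msets_def)
    then have "{#x\<in>#M. snd x = i#} = {#}" "{#x\<in>#M. snd x \<noteq> i#} = M"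
      by (auto simp: filter_mset_eq_conv)
    then show ?thesis
      by (simp add: x filter_mset_image_mset multiset.map_comp o_def)
  qed
  show "?f (?g M) = M" if "M \<in> coloured_msets (insert i I) n" for M
  proof -
    have "image_mset (\<lambda>b. (b, i)) (image_mset fst {#x\<in>#M. snd x = i#}) = {#x\<in>#M. snd x = i#}"
      by (auto simp: multiset.map_comp intro!: multiset.map_ident_strong)
    then show ?thesis by (simp add: multiset_partition[symmetric])
  qed
qed

text \<open>Colours are added one at a time, each contributing an independent factor. Finiteness of
  the fibres is carried through the induction because the product rule requires it; excluding colour
  0 guarantees it.\<close>

lemma counting_fps_coloured_msets:
  assumes "finite I" "0 \<notin> I"
  shows "(\<forall>N. finite {M\<in>coloured_msets I n. weight M = N}) \<and>
    counting_fps (coloured_msets I n) weight *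
      (\<Prod>i\<in>I. q_pochhammer (fps_X ^ i) (fps_X ^ i) (n i)) = (1 :: 'a::comm_ring_1 fps)"
  using assms
proof (induction I rule: finite_induct)
  case empty
  have *: "coloured_msets {} n = {{#}}"
    by (auto simp: coloured_msets_def)
  have "card {x::(nat\<times>nat) multiset. x = {#} \<and> weight x = N} = (if N = 0 then 1 else 0)" for N
  proof -
    have "{x::(nat\<times>nat) multiset. x = {#} \<and> weight x = N} = (if N = 0 then {{#}} else {})"
      by auto
    then show ?thesis by simp
  qed
  then show ?case
    by (simp add: * counting_fps_def fps_eq_iff)
next
  case (insert i I)
  let ?P = "{B. size B = n i} :: nat multiset set" and ?Q = "coloured_msets I n"
  let ?f = "\<lambda>(B, M). image_mset (\<lambda>b. (b, i)) B + M"
  let ?w = "\<lambda>B. i * sum_mset B"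
  let ?v = "\<lambda>(B, M). ?w B + weight M"
  have bij: "bij_betw ?f (?P \<times> ?Q) (coloured_msets (insert i I) n)"
    by (rule coloured_msets_insert) (use insert in auto)
  have "weight (image_mset (\<lambda>b. (b, i)) B) = i * sum_mset B" for B
    by (induction B) (auto simp: algebra_simps)
  then have weight: "weight (?f x) = ?v x" for x
    by (cases x) simp
  have finP: "finite {B\<in>?P. ?w B = N}" for N
    using finite_mset_sum_eq[of i "n i" N] insert by auto
  have finQ: "finite {M\<in>?Q. weight M = N}" for N
    using insert by auto
  have "{M\<in>coloured_msets (insert i I) n. weight M = N} = ?f ` {x \<in> ?P \<times> ?Q. ?v x = N}" for N
    by (simp only: bij_betw_imp_surj_on[OF bij, symmetric] Compr_image_eq weight)
  then have "finite {M\<in>coloured_msets (insert i I) n. weight M = N}" for N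
    using finite_Times_weight[of ?P ?w ?Q weight, OF finP finQ, of N] by simp
  moreover have "counting_fps (coloured_msets (insert i I) n) weight =
      (counting_fps ?P ?w * counting_fps ?Q weight :: 'a fps)"
    by (subst counting_fps_bij_betw[where w = ?v, OF bij weight])
       (rule counting_fps_Times[of ?P ?w ?Q weight, OF finP finQ])
  moreover have "counting_fps ?P ?w * q_pochhammer (fps_X ^ i) (fps_X ^ i) (n i) = (1 :: 'a fps)"
    by (rule counting_fps_mset_mult_pochhammer) (use insert in auto)
  moreover have "counting_fps ?Q weight * (\<Prod>j\<in>I. q_pochhammer (fps_X ^ j) (fps_X ^ j) (n j)) = (1 :: 'a fps)"
    using insert by simp
  moreover have "(a * c) * (b * d) = 1" if "a * b = 1" "c * d = 1" for a b c d :: "'a fps"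
    using that by (metis mult.assoc mult.commute mult.right_neutral)
  ultimately show ?case
    by (simp only: prod.insert[OF insert(1,2)]) blast
qed


subsection \<open>Gap-frequency partitions as sorted lists of blocks\<close>

text \<open>The reversal in the second component mirrors the clause of \<open>gap_frequency\<close>
  that forbids a larger multiplicity when the next part is exactly \<open>a + i\<close>.\<close>

fun block_le :: "nat \<times> nat \<Rightarrow> nat \<times> nat \<Rightarrow> bool" where
  "block_le (b, i) (b', i') \<longleftrightarrow> b < b' \<or> b = b' \<and> i' \<le> i"

text \<open>Sorted insertion gives existence. For uniqueness, the head of a sorted list is its least
  element.\<close>

lemma bij_betw_mset_sorted_wrt:
  assumes "class.linorder le lt"
  shows "bij_betw mset {xs. sorted_wrt le xs} UNIV"
proof -
  interpret linorder le lt by (rule assms)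
  have "xs = ys" if "sorted xs" "sorted ys" "mset xs = mset ys" for xs ys
    using that
  proof (induction xs arbitrary: ys)
    case (Cons x xs)
    then obtain y ys' where ys: "ys = y # ys'" by (cases ys) auto
    have "set (x # xs) = set ys" using Cons.prems(3) by (metis set_mset_mset)
    then have "le x y" "le y x" using Cons.prems(1,2) by (auto simp: ys)
    then have "x = y" by (rule order.antisym)
    then show ?case using Cons by (simp add: ys)
  qed simp
  moreover have "\<exists>xs. sorted xs \<and> mset xs = M" for M
  proof (induction M)
    case (add x M)
    then obtain xs where xs: "sorted xs" "mset xs = M" by auto
    have "sorted (insort x xs)" using xs by (simp add: sorted_insort)
    moreover have "mset (insort x xs) = add_mset x (mset xs)"
      by (induction xs) auto
    ultimately show ?case using xs by auto
  qed (auto intro: exI[of _ "[]"])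
  ultimately show ?thesis
    by (auto simp: bij_betw_def inj_on_def) (metis (mono_tags, lifting) imageI mem_Collect_eq)
qed

lemma linorder_block_le: "class.linorder block_le (\<lambda>x y. block_le x y \<and> \<not> block_le y x)"
  by unfold_locales auto

text \<open>The first argument is the sum of the multiplicities of the blocks already written.\<close>

fun unblock :: "nat \<Rightarrow> (nat \<times> nat) list \<Rightarrow> nat list" where
  "unblock s [] = []"
| "unblock s ((b, i) # L) = replicate i (Suc (s + b)) @ unblock (s + i) L"

definition block_lists :: "nat \<Rightarrow> (nat \<times> nat) list set" where
  "block_lists k = {L. sorted_wrt block_le L \<and> snd ` set L \<subseteq> {1..k}}"

lemma block_lists_Nil: "[] \<in> block_lists k"
  by (simp add: block_lists_def)

lemma block_lists_Cons:
  "(b, i) # L \<in> block_lists k \<longleftrightarrow>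
     i \<in> {1..k} \<and> L \<in> block_lists k \<and> (\<forall>x\<in>set L. block_le (b, i) x)"
  by (auto simp: block_lists_def)

lemma unblock_lower_bound:
  assumes "\<forall>x\<in>set L. b \<le> fst x" "c \<in> set (unblock s L)"
  shows "s + b < c"
  using assms by (induction s L rule: unblock.induct) (fastforce split: if_splits)+

text \<open>Sortedness keeps the first components in the tail at least \<open>b\<close>, and the
  tail is written with offset \<open>s + i\<close>. This is the source of the gap of at least
  \<open>i\<close>.\<close>

lemma unblock_tail_bound:
  assumes "(b, i) # L \<in> block_lists k" "c \<in> set (unblock (s + i) L)"
  shows "Suc (s + b) + i \<le> c"
  using unblock_lower_bound[of L b c "s + i"] assms by (fastforce simp: block_lists_Cons)

lemma count_list_replicate: "count_list (replicate n x) y = (if x = y then n else 0)"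
  by (induction n) auto

section \<open>The gap condition after prepending copies of a smaller part\<close>

lemma next_larger_part_hd:
  assumes "sorted p" "\<forall>c\<in>set p. a < c"
  shows "next_larger_part (replicate i a @ p) a b \<longleftrightarrow> p \<noteq> [] \<and> b = hd p"
proof
  assume b: "next_larger_part (replicate i a @ p) a b"
  then have "b \<in> set p" by (auto simp: next_larger_part_def split: if_splits)
  then show "p \<noteq> [] \<and> b = hd p"
    using b assms by (cases p) (auto simp: next_larger_part_def intro: antisym)
next
  assume "p \<noteq> [] \<and> b = hd p"
  then show "next_larger_part (replicate i a @ p) a b"
    using assms by (cases p) (auto simp: next_larger_part_def)
qed

text \<open>Prepending a smaller part changes neither the successors nor the multiplicities of the
  parts of \<open>p\<close>. The one new condition concerns \<open>a\<close>, whose successor is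
  \<open>hd p\<close>.\<close>

lemma gap_frequency_replicate_append:
  assumes "i \<ge> 1" "a \<ge> 1" "\<forall>c\<in>set p. a < c"
  shows "gap_frequency (replicate i a @ p) \<longleftrightarrow> gap_frequency p \<and>
    (p \<noteq> [] \<longrightarrow> a + i \<le> hd p \<and> (hd p = a + i \<longrightarrow> count_list p (hd p) \<le> i))"
proof (cases "is_partition p")
  case True
  let ?r = "replicate i a @ p"
  have part: "is_partition ?r"
    using True assms by (fastforce simp: is_partition_def sorted_append sorted_replicate)
  have cnt: "count_list ?r c = (if c = a then i else count_list p c)" for c
    using assms by (auto simp: count_list_replicate)
  have next_tail: "next_larger_part ?r c d \<longleftrightarrow> next_larger_part p c d" if "c \<in> set p" for c d
    using that assms by (fastforce simp: next_larger_part_def split: if_splits)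
  have next_a: "next_larger_part ?r a d \<longleftrightarrow> p \<noteq> [] \<and> d = hd p" for d
    using True assms by (intro next_larger_part_hd) (auto simp: is_partition_def)
  have set_r: "set ?r = insert a (set p)"
    using assms by (cases i) auto
  have neq: "d \<noteq> a" if "next_larger_part p c d" for c d
    using that assms by (auto simp: next_larger_part_def)
  have neq': "c \<noteq> a" if "c \<in> set p" for c
    using that assms by auto
  have "hd p \<noteq> a" if "p \<noteq> []"
    using that neq' by auto
  then show ?thesis
    unfolding gap_frequency_def set_r
    using part True neq neq' by (auto simp: next_tail next_a cnt simp del: count_list_append)
next
  case False
  moreover have "\<not> is_partition (replicate i a @ p)"
    using False by (auto simp: is_partition_def sorted_append)
  ultimately show ?thesis by (simp add: gap_frequency_def)
qed

lemma gap_frequency_upto_replicate_append: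
  assumes "i \<ge> 1" "a \<ge> 1" "\<forall>c\<in>set p. a < c"
  shows "replicate i a @ p \<in> gap_frequency_upto k \<longleftrightarrow> i \<le> k \<and> p \<in> gap_frequency_upto k \<and>
    (p \<noteq> [] \<longrightarrow> a + i \<le> hd p \<and> (hd p = a + i \<longrightarrow> count_list p (hd p) \<le> i))"
proof -
  have "a \<notin> set p" using assms by auto
  then have "(\<forall>c. count_list (replicate i a @ p) c \<le> k) \<longleftrightarrow> i \<le> k \<and> (\<forall>c. count_list p c \<le> k)"
    using assms by (auto simp: count_list_replicate) 
  then show ?thesis
    using gap_frequency_replicate_append[OF assms] by (auto simp: gap_frequency_upto_def)
qed

section \<open>The bijection between block lists and partitions\<close>

lemma gap_frequency_upto_Nil: "[] \<in> gap_frequency_upto k"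
  by (simp add: gap_frequency_upto_def gap_frequency_def is_partition_def)

text \<open>The first block can be read off from the partition: the least part determines
  \<open>b\<close>, and its multiplicity is \<open>i\<close> because later blocks lie strictly above
  it.\<close>

lemma unblock_Cons_hd:
  assumes "(b, i) # L \<in> block_lists k"
  shows "unblock s ((b, i) # L) \<noteq> []" "hd (unblock s ((b, i) # L)) = Suc (s + b)"
    "count_list (unblock s ((b, i) # L)) (Suc (s + b)) = i"
proof -
  have i: "i \<ge> 1" using assms by (auto simp: block_lists_Cons)
  then show "unblock s ((b, i) # L) \<noteq> []" "hd (unblock s ((b, i) # L)) = Suc (s + b)"
    by (cases i; simp)+
  have "Suc (s + b) \<notin> set (unblock (s + i) L)"
    using unblock_tail_bound[OF assms] i by fastforce
  then show "count_list (unblock s ((b, i) # L)) (Suc (s + b)) = i"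
    by (simp add: count_list_replicate)
qed

text \<open>If the next block is \<open>(b', i')\<close>, the next part exceeds
  \<open>Suc (s + b) + i\<close> by \<open>b' - b\<close>. Equality thus means
  \<open>b' = b\<close>, and then \<open>block_le\<close> supplies \<open>i' <= i\<close>.\<close>

lemma unblock_in_gap_frequency_upto:
  "L \<in> block_lists k \<Longrightarrow> unblock s L \<in> gap_frequency_upto k"
proof (induction s L rule: unblock.induct)
  case (1 s)
  then show ?case by (simp add: gap_frequency_upto_Nil)
next
  case (2 s b i L)
  let ?p = "unblock (s + i) L"
  have L: "L \<in> block_lists k" and i: "1 \<le> i" "i \<le> k" using 2(2) by (auto simp: block_lists_Cons)
  have hd: "Suc (s + b) + i \<le> hd ?p \<and> (hd ?p = Suc (s + b) + i \<longrightarrow> count_list ?p (hd ?p) \<le> i)"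
    if nonempty: "?p \<noteq> []"
  proof -
    obtain b' i' L' where L': "L = (b', i') # L'" using nonempty by (cases L) auto
    then have "hd ?p = Suc (s + i + b')" "count_list ?p (hd ?p) = i'"
      using unblock_Cons_hd[of b' i' L' k "s + i"] L by auto
    moreover have "block_le (b, i) (b', i')" using 2(2) L' by (simp add: block_lists_Cons)
    ultimately show ?thesis by auto
  qed
  have "\<forall>c\<in>set ?p. Suc (s + b) < c"
    using unblock_tail_bound[OF 2(2)] i by fastforce
  then show ?case
    using gap_frequency_upto_replicate_append[of i "Suc (s + b)" ?p k] 2(1)[OF L] i hd by simp
qed

lemma sorted_eq_replicate_hd_append:
  fixes p :: "nat list"
  assumes "sorted (a # p)"
  shows "p = replicate (count_list p a) a @ filter ((<) a) p"
  using assms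
proof (induction p)
  case (Cons c p)
  show ?case
  proof (cases "c = a")
    case False
    then have "\<forall>x\<in>set (c # p). a < x" using Cons.prems by auto
    then have "filter ((<) a) (c # p) = c # p" "a \<notin> set (c # p)"
      by (auto simp only: filter_id_conv)
    then show ?thesis by simp
  qed (use Cons in auto)
qed simp

text \<open>The copies of the least part are split off as the first block, and induction on the
  length treats the rest. The offset \<open>s\<close> is general since the rest is written with
  offset \<open>s + i\<close>.\<close>

lemma ex_unblock:
  assumes "p \<in> gap_frequency_upto k" "\<forall>c\<in>set p. s < c"
  shows "\<exists>L\<in>block_lists k. unblock s L = p"
  using assms
proof (induction "length p" arbitrary: p s rule: less_induct)
  case less
  show ?case
  proof (cases "p = []")
    case True
    then show ?thesis by (auto intro!: bexI[of _ "[]"] simp: block_lists_Nil)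
  next
    case False
    define a where "a = hd p"
    define i where "i = count_list p a"
    define p' where "p' = filter ((<) a) p"
    have "sorted p" using less.prems(1)
      by (simp add: gap_frequency_upto_def gap_frequency_def is_partition_def)
    then have "sorted (a # p)" using False by (cases p) (auto simp: a_def)
    then have p: "p = replicate i a @ p'"
      unfolding i_def p'_def by (rule sorted_eq_replicate_hd_append)
    have "a \<in> set p" using False by (simp add: a_def)
    then have i: "i \<ge> 1" and a: "s < a"
      using less.prems(2) count_list_0_iff[of p a] by (auto simp: i_def Suc_le_eq)
    have gt: "\<forall>c\<in>set p'. a < c" by (simp add: p'_def)
    have *: "i \<le> k" "p' \<in> gap_frequency_upto k"
      "p' \<noteq> [] \<Longrightarrow> a + i \<le> hd p'" "p' \<noteq> [] \<Longrightarrow> hd p' = a + i \<Longrightarrow> count_list p' (hd p') \<le> i"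
      using less.prems(1) gap_frequency_upto_replicate_append[OF i _ gt, of k] a
      unfolding p[symmetric] by auto
    have "sorted p'" using \<open>sorted p\<close> by (simp add: p'_def sorted_wrt_filter)
    then have "\<forall>c\<in>set p'. s + i < c"
      using *(3) a by (cases p') auto
    moreover have "length p' < length p" using i by (subst p) simp
    ultimately obtain L where L: "L \<in> block_lists k" "unblock (s + i) L = p'"
      using less.hyps[of p' "s + i"] *(2) by auto
    \<comment> \<open>Sortedness of \<open>L\<close> reduces this to its head. There the gap
      condition gives \<open>a - Suc s <= b'\<close>; equality means \<open>hd p' = a + i\<close>,
      which forces \<open>i' <= i\<close>.\<close>
    have le: "block_le (a - Suc s, i) x" if x: "x \<in> set L" for x
    proof -
      obtain b' i' L' where L': "L = (b', i') # L'" using x by (cases L) auto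
      then have hd: "p' \<noteq> []" "hd p' = Suc (s + i + b')" "count_list p' (hd p') = i'"
        using unblock_Cons_hd[of b' i' L' k "s + i"] L by auto
      then have "block_le (a - Suc s, i) (b', i')"
        using *(3,4) a by auto
      moreover have "x = (b', i') \<or> block_le (b', i') x"
        using x L(1) by (auto simp: L' block_lists_Cons)
      ultimately show ?thesis by (cases x) auto
    qed
    \<comment> \<open>The first component solves \<open>Suc (s + b) = a\<close>; the truncated
      subtraction is exact because \<open>s < a\<close>.\<close>
    show ?thesis
      by (rule bexI[of _ "(a - Suc s, i) # L"]) (use L le a i *(1) in \<open>auto simp: p block_lists_Cons\<close>)
  qed
qed

lemma unblock_inject:
  assumes "L \<in> block_lists k" "L' \<in> block_lists k" "unblock s L = unblock s L'"
  shows "L = L'"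
  using assms
proof (induction s L arbitrary: L' rule: unblock.induct)
  case (1 s)
  then show ?case using unblock_Cons_hd(1)[of _ _ _ k s] by (cases L') force+
next
  case (2 s b i L)
  obtain b' i' M where L': "L' = (b', i') # M"
    using 2 unblock_Cons_hd(1)[of b i L k s] by (cases L') auto
  have "b' = b" using unblock_Cons_hd(2)[OF 2(2), of s] unblock_Cons_hd(2)[of b' i' M k s] 2 L' by simp
  moreover have "i' = i"
    using unblock_Cons_hd(3)[OF 2(2), of s] unblock_Cons_hd(3)[of b' i' M k s] 2(3,4) \<open>b' = b\<close> 
    unfolding L' by metis
  ultimately show ?case
    using 2 L' by (auto simp: block_lists_Cons)
qed

lemma bij_betw_unblock: "bij_betw (unblock 0) (block_lists k) (gap_frequency_upto k)"
proof (rule bij_betw_imageI)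
  show "inj_on (unblock 0) (block_lists k)"
    by (auto intro: inj_onI unblock_inject)
  have "\<forall>c\<in>set p. 0 < c" if "p \<in> gap_frequency_upto k" for p
    using that by (simp add: gap_frequency_upto_def gap_frequency_def is_partition_def)
  then have "p \<in> unblock 0 ` block_lists k" if "p \<in> gap_frequency_upto k" for p
    using ex_unblock[of p k 0] that by (auto simp only: image_iff)
  then show "unblock 0 ` block_lists k = gap_frequency_upto k"
    using unblock_in_gap_frequency_upto[of _ k 0] by auto
qed

section \<open>Multiplicities, length and size in terms of blocks\<close>

text \<open>Different blocks carry different part values, so each block with second component
  \<open>j\<close> adds one value. With \<open>j >= 1\<close> the set of values is finite, so
  \<open>card\<close> really counts it.\<close>

lemma parts_repeated_unblock:
  assumes "L \<in> block_lists k" "j \<ge> 1"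
  shows "parts_repeated j (unblock s L) = count_list (map snd L) j"
  using assms
proof (induction s L rule: unblock.induct)
  case (1 s)
  then show ?case by (simp add: parts_repeated_def)
next
  case (2 s b i L)
  let ?p = "unblock (s + i) L" and ?a = "Suc (s + b)"
  have i: "i \<ge> 1" using 2(2) by (simp add: block_lists_Cons)
  have notin: "?a \<notin> set ?p"
    using unblock_tail_bound[OF 2(2)] i by fastforce
  have "finite {c. count_list ?p c = j}"
  proof (rule finite_subset[of _ "set ?p"])
    have "c \<in> set ?p" if "count_list ?p c = j" for c
      using that 2(3) by (cases "c \<in> set ?p") auto
    then show "{c. count_list ?p c = j} \<subseteq> set ?p"
      by auto
  qed simp
  moreover have "{c. count_list (replicate i ?a @ ?p) c = j} =
      (if i = j then insert ?a {c. count_list ?p c = j} else {c. count_list ?p c = j})"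
    using notin 2(3) by (auto simp: count_list_replicate)
  moreover have "?a \<notin> {c. count_list ?p c = j}"
    using notin 2(3) by simp
  ultimately show ?case
    using 2 by (cases "i = j") (simp_all add: parts_repeated_def block_lists_Cons del: count_list_append)
qed

lemma length_unblock: "length (unblock s L) = (\<Sum>i\<leftarrow>map snd L. i)"
  by (induction s L rule: unblock.induct) auto

text \<open>The growing offsets produce the sum of \<open>i_l * i_j\<close> over pairs of blocks,
  which is half of the squared sum minus the sum of squares. Doubling and moving the squares to the
  left avoids division and subtraction in \<open>nat\<close>.\<close>

lemma sum_list_unblock:
  "2 * sum_list (unblock s L) + (\<Sum>i\<leftarrow>map snd L. i\<^sup>2) =
     2 * (\<Sum>(b, i)\<in>#mset L. i * b) + 2 * s * (\<Sum>i\<leftarrow>map snd L. i) +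
     (\<Sum>i\<leftarrow>map snd L. i)\<^sup>2 + 2 * (\<Sum>i\<leftarrow>map snd L. i)"
  by (induction s L rule: unblock.induct) (simp_all add: sum_list_replicate algebra_simps power2_eq_square)

text \<open>This is the size when all \<open>b\<close> are 0, hence the least size for given block
  counts \<open>n\<close>.\<close>

definition min_weight :: "nat \<Rightarrow> (nat \<Rightarrow> nat) \<Rightarrow> nat" where
  "min_weight k n = (\<Sum>i=1..k. i\<^sup>2 * (n i choose 2) + i * n i) +
     (\<Sum>i=1..k. \<Sum>j=i+1..k. i * j * n i * n j)"

text \<open>The doubled form is that of \<open>sum_list_unblock\<close>, so that the two can be
  compared.\<close>

lemma min_weight_eq:
  "2 * min_weight k n + (\<Sum>i=1..k. n i * i\<^sup>2) = (\<Sum>i=1..k. n i * i)\<^sup>2 + 2 * (\<Sum>i=1..k. n i * i)"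
proof (induction k)
  case 0
  show ?case by (simp add: min_weight_def)
next
  case (Suc k)
  let ?m = "n (Suc k)" and ?W = "\<Sum>i=1..k. n i * i"
  \<comment> \<open>The column \<open>j = Suc k\<close> is split off each row, while the row
    \<open>i = Suc k\<close> is empty.\<close>
  have "(\<Sum>i=1..Suc k. \<Sum>j=i+1..Suc k. i * j * n i * n j) =
        (\<Sum>i=1..k. (\<Sum>j=i+1..k. i * j * n i * n j) + i * Suc k * n i * ?m)"
    by (auto intro!: sum.cong simp: algebra_simps)
  also have "\<dots> = (\<Sum>i=1..k. \<Sum>j=i+1..k. i * j * n i * n j) + (\<Sum>i=1..k. i * Suc k * n i * ?m)"
    by (rule sum.distrib)
  also have "(\<Sum>i=1..k. i * Suc k * n i * ?m) = ?W * Suc k * ?m"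
    unfolding sum_distrib_right by (rule sum.cong) (simp_all only: mult_ac)
  finally have "min_weight (Suc k) n = min_weight k n + ((Suc k)\<^sup>2 * (?m choose 2) + Suc k * ?m) + ?W * Suc k * ?m"
    by (simp add: min_weight_def)
  moreover have "2 * (?m choose 2) + ?m = ?m\<^sup>2"
    by (cases ?m) (auto simp: choose_two power2_eq_square)
  then have "2 * ((Suc k)\<^sup>2 * (?m choose 2)) + ?m * (Suc k)\<^sup>2 = (?m * Suc k)\<^sup>2"
    by (metis (no_types) add_mult_distrib2 mult.assoc mult.commute power_mult_distrib)
  moreover have "(\<Sum>i=1..Suc k. n i * i) = ?W + ?m * Suc k"
    "(\<Sum>i=1..Suc k. n i * i\<^sup>2) = (\<Sum>i=1..k. n i * i\<^sup>2) + ?m * (Suc k)\<^sup>2"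
    by simp_all
  moreover have "(?W + ?m * Suc k)\<^sup>2 = ?W\<^sup>2 + 2 * (?W * Suc k * ?m) + (?m * Suc k)\<^sup>2"
    by (simp only: power2_sum) (simp only: mult_ac)
  ultimately show ?case
    using Suc by (simp only: mult.commute[of "Suc k" ?m] distrib_left)
qed

lemma sum_list_map_eq_sum_parts:
  assumes "L \<in> block_lists k"
  shows "(\<Sum>i\<leftarrow>map snd L. f i) = (\<Sum>i=1..k. parts_repeated i (unblock 0 L) * f i)"
proof -
  have "(\<Sum>i\<leftarrow>map snd L. f i) = (\<Sum>i=1..k. count_list (map snd L) i * f i)"
    using assms by (intro sum_list_map_eq_sum_count2) (auto simp: block_lists_def)
  then show ?thesis
    by (simp add: parts_repeated_unblock[OF assms])
qed

text \<open>At offset 0 the quadratic and linear terms of the two doubled identities agree and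
  cancel.\<close>

lemma sum_list_unblock_0:
  assumes "L \<in> block_lists k"
  shows "sum_list (unblock 0 L) =
    min_weight k (\<lambda>i. parts_repeated i (unblock 0 L)) + (\<Sum>(b, i)\<in>#mset L. i * b)"
  using sum_list_unblock[of 0 L] min_weight_eq[of k "\<lambda>i. parts_repeated i (unblock 0 L)"]
    sum_list_map_eq_sum_parts[OF assms, of "\<lambda>i. i"] sum_list_map_eq_sum_parts[OF assms, of "\<lambda>i. i\<^sup>2"]
  by simp

lemma length_eq_sum_parts_repeated:
  assumes "p \<in> gap_frequency_upto k"
  shows "length p = (\<Sum>i=1..k. i * parts_repeated i p)"
proof -
  obtain L where "L \<in> block_lists k" "p = unblock 0 L"
    using assms bij_betw_imp_surj_on[OF bij_betw_unblock] by blast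
  then show ?thesis
    using sum_list_map_eq_sum_parts[of L k "\<lambda>i. i"] by (simp add: length_unblock mult.commute)
qed

lemma finite_gap_frequency_upto_sum_list: "finite {p\<in>gap_frequency_upto k. sum_list p = N}"
proof (rule finite_subset)
  show "{p\<in>gap_frequency_upto k. sum_list p = N} \<subseteq> {p. set p \<subseteq> {..N} \<and> length p \<le> N}"
  proof safe
    fix p assume "p \<in> gap_frequency_upto k"
    then have "\<forall>a\<in>set p. a > 0"
      by (simp add: gap_frequency_upto_def gap_frequency_def is_partition_def)
    then show "length p \<le> sum_list p"
      by (induction p) (auto simp: Suc_le_eq)
  qed (auto simp: member_le_sum_list)
qed (simp add: finite_lists_length_le)

subsection \<open>The generating function identity\<close>

text \<open>The range and the numbers of the colours depend only on the underlying multiset, so the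
  sorting bijection restricts.\<close>

lemma bij_betw_blocks_coloured_msets:
  "bij_betw mset {L\<in>block_lists k. \<forall>i\<in>{1..k}. count_list (map snd L) i = n i} (coloured_msets {1..k} n)"
proof -
  have "count (image_mset snd (mset L)) i = count_list (map snd L) i" for i and L :: "(nat \<times> nat) list"
    by (induction L) auto
  then have eq: "{L\<in>block_lists k. \<forall>i\<in>{1..k}. count_list (map snd L) i = n i} =
      {L\<in>{L. sorted_wrt block_le L}. mset L \<in> coloured_msets {1..k} n}"
    by (simp add: block_lists_def coloured_msets_def conj_assoc)
  have "bij_betw mset {L. sorted_wrt block_le L} UNIV"
    by (rule bij_betw_mset_sorted_wrt[OF linorder_block_le])
  then have inj: "inj_on mset {L. sorted_wrt block_le L}" and surj: "mset ` {L. sorted_wrt block_le L} = UNIV"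
    by (simp_all add: bij_betw_def)
  show ?thesis
    unfolding eq
  proof (rule bij_betw_imageI)
    show "inj_on mset {L\<in>{L. sorted_wrt block_le L}. mset L \<in> coloured_msets {1..k} n}"
      by (rule inj_on_subset[OF inj]) auto
    have "mset ` {L\<in>{L. sorted_wrt block_le L}. mset L \<in> coloured_msets {1..k} n} =
        {M\<in>mset ` {L. sorted_wrt block_le L}. M \<in> coloured_msets {1..k} n}"
      by (rule Compr_image_eq[symmetric])
    then show "mset ` {L\<in>{L. sorted_wrt block_le L}. mset L \<in> coloured_msets {1..k} n} = coloured_msets {1..k} n"
      by (simp only: surj UNIV_I simp_thms Collect_mem_eq)
  qed
qed

definition partitions_with_content :: "nat \<Rightarrow> (nat \<Rightarrow> nat) \<Rightarrow> nat list set" where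
  "partitions_with_content k n = {p\<in>gap_frequency_upto k. \<forall>i\<in>{1..k}. parts_repeated i p = n i}"

lemma bij_betw_blocks_partitions:
  "bij_betw (unblock 0) {L\<in>block_lists k. \<forall>i\<in>{1..k}. count_list (map snd L) i = n i}
     (partitions_with_content k n)"
proof -
  have eq: "{L\<in>block_lists k. \<forall>i\<in>{1..k}. count_list (map snd L) i = n i} =
      {L\<in>block_lists k. \<forall>i\<in>{1..k}. parts_repeated i (unblock 0 L) = n i}"
    by (auto simp: parts_repeated_unblock)
  have "unblock 0 ` {L\<in>block_lists k. \<forall>i\<in>{1..k}. parts_repeated i (unblock 0 L) = n i} =
      partitions_with_content k n"
    unfolding partitions_with_content_def bij_betw_imp_surj_on[OF bij_betw_unblock, symmetric]
    by (rule Compr_image_eq[symmetric])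
  then show ?thesis
    unfolding eq by (intro bij_betw_imageI inj_on_subset[OF bij_betw_imp_inj_on[OF bij_betw_unblock]]) auto
qed

lemma min_weight_cong:
  assumes "\<And>i. i \<in> {1..k} \<Longrightarrow> m i = n i"
  shows "min_weight k m = min_weight k n"
  unfolding min_weight_def using assms by (intro arg_cong2[where f = "(+)"] sum.cong) auto

lemma counting_fps_partitions:
  "counting_fps (partitions_with_content k n) sum_list =
     fps_X ^ min_weight k n * counting_fps (coloured_msets {1..k} n) weight"
proof -
  let ?B = "{L\<in>block_lists k. \<forall>i\<in>{1..k}. count_list (map snd L) i = n i}"
  have "sum_list (unblock 0 L) = min_weight k n + weight (mset L)" if "L \<in> ?B" for L
  proof -
    have "min_weight k (\<lambda>i. parts_repeated i (unblock 0 L)) = min_weight k n"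
      using that by (intro min_weight_cong) (auto simp: parts_repeated_unblock)
    then show ?thesis
      using that sum_list_unblock_0[of L k] by simp
  qed
  then have "counting_fps (partitions_with_content k n) sum_list =
      (counting_fps ?B (\<lambda>L. min_weight k n + weight (mset L)) :: 'a fps)"
    by (rule counting_fps_bij_betw[OF bij_betw_blocks_partitions])
  also have "\<dots> = fps_X ^ min_weight k n * counting_fps ?B (\<lambda>L. weight (mset L))"
    by (rule counting_fps_shift)
  also have "counting_fps ?B (\<lambda>L. weight (mset L)) = (counting_fps (coloured_msets {1..k} n) weight :: 'a fps)"
    by (rule counting_fps_bij_betw[OF bij_betw_blocks_coloured_msets, symmetric]) simp
  finally show ?thesis .
qed

section \<open>Summands of both series\<close>

text \<open>This turns the product identities equal to 1 into the inverse used in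
  \<open>series_term\<close>.\<close>

lemma fps_right_inverse_unique:
  fixes f g :: "'a::comm_ring_1 fps"
  assumes "g * f = 1" "fps_nth f 0 = 1"
  shows "fps_right_inverse f 1 = g"
proof -
  have "f * fps_right_inverse f 1 = 1"
    by (rule fps_right_inverse) (simp add: assms)
  then have "g = g * f * fps_right_inverse f 1"
    by (simp add: mult.assoc)
  then show ?thesis
    by (simp add: assms)
qed

definition content_monomial :: "nat \<Rightarrow> (nat \<Rightarrow> nat) \<Rightarrow> (nat \<Rightarrow>\<^sub>0 nat) \<Rightarrow>\<^sub>0 int" where
  "content_monomial k n = Poly_Mapping.single (Poly_Mapping.single 1 1) 1 ^ (\<Sum>i=1..k. i * n i) *
     (\<Prod>i=2..k. Poly_Mapping.single (Poly_Mapping.single i 1) 1 ^ n i)"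

lemma content_monomial_cong:
  assumes "\<And>i. i \<in> {1..k} \<Longrightarrow> m i = n i"
  shows "content_monomial k m = content_monomial k n"
  unfolding content_monomial_def using assms
  by (intro arg_cong2[where f = "(*)"] arg_cong2[where f = "(^)"] sum.cong prod.cong) auto

lemma fps_const_content_monomial:
  "fps_const (content_monomial k n) = x_var 1 ^ (\<Sum>i=1..k. i * n i) * (\<Prod>i=2..k. x_var i ^ n i)"
proof -
  have "fps_const (prod f A) = (\<Prod>i\<in>A. fps_const (f i))" for A and f :: "nat \<Rightarrow> ((nat \<Rightarrow>\<^sub>0 nat) \<Rightarrow>\<^sub>0 int)"
    by (induction A rule: infinite_finite_induct) (auto simp flip: fps_const_mult)
  then show ?thesis
    by (simp add: content_monomial_def x_var_def flip: fps_const_mult fps_const_power)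
qed

text \<open>Expressing the length through the \<open>parts_repeated i p\<close> makes the monomial
  depend on these numbers alone.\<close>

lemma partition_term_eq:
  assumes "p \<in> gap_frequency_upto k"
  shows "partition_term k p = fps_const (content_monomial k (\<lambda>i. parts_repeated i p)) * fps_X ^ sum_list p"
  by (simp only: partition_term_def fps_const_content_monomial length_eq_sum_parts_repeated[OF assms] q_var_def)

text \<open>The numerator supplies the monomial and \<open>min_weight\<close>, the inverse
  denominator the coloured multisets. What remains for the theorem is to group partitions by
  content.\<close>

lemma series_term_eq:
  "series_term k n = fps_const (content_monomial k n) * counting_fps (partitions_with_content k n) sum_list"
proof -
  have "fps_right_inverse (series_denominator k n) 1 = counting_fps (coloured_msets {1..k} n) weight"
  proof (rule fps_right_inverse_unique)
    show "counting_fps (coloured_msets {1..k} n) weight * series_denominator k n = 1"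
      unfolding series_denominator_def q_var_def
      by (rule conjunct2[OF counting_fps_coloured_msets]) auto
  qed (rule series_denominator_nth_0)
  then show ?thesis
    unfolding series_term_def counting_fps_partitions fps_const_content_monomial
    by (simp add: series_numerator_def min_weight_def q_var_def mult.assoc)
qed

theorem theorem1p6:
  fixes k :: nat
  assumes "k \<ge> 2"
  shows "partition_term k summable_on gap_frequency_upto k \<and>
         series_term k summable_on ({1..k} \<rightarrow>\<^sub>E (UNIV :: nat set)) \<and>
         (\<Sum>\<^sub>\<infinity>p\<in>gap_frequency_upto k. partition_term k p) =
         (\<Sum>\<^sub>\<infinity>n\<in>({1..k} \<rightarrow>\<^sub>E (UNIV :: nat set)). series_term k n)"
proof -
  let ?S = "gap_frequency_upto k" and ?E = "{1..k} \<rightarrow>\<^sub>E (UNIV :: nat set)"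
  \<comment> \<open>The restricted abstraction makes \<open>content p\<close> an element of
    \<open>?E\<close>, so it can serve as an index of the series.\<close>
  define content where "content p = (\<lambda>i\<in>{1..k}. parts_repeated i p)" for p
  define x where "x = content_monomial k"
  define F where "F N = {p\<in>?S. sum_list p = N}" for N
  \<comment> \<open>Both sums are shown to equal \<open>T\<close>, whose coefficients are finite
    sums.\<close>
  define T where "T = Abs_fps (\<lambda>N. \<Sum>p\<in>F N. x (content p))"
  have fin: "finite (F N)" for N
    unfolding F_def by (rule finite_gap_frequency_upto_sum_list)
  have "content_monomial k (\<lambda>i. parts_repeated i p) = x (content p)" for p
    unfolding x_def content_def by (rule content_monomial_cong) simp
  then have pt: "fps_nth (partition_term k p) N = (if p \<in> F N then x (content p) else 0)" if "p \<in> ?S" for p N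
    using that by (auto simp: partition_term_eq F_def fps_X_power_nth)
  have "{p\<in>partitions_with_content k n. sum_list p = N} = {p\<in>F N. content p = n}" if "n \<in> ?E" for n N
  proof -
    have "content p = n \<longleftrightarrow> (\<forall>i\<in>{1..k}. parts_repeated i p = n i)" for p
    proof
      assume "\<forall>i\<in>{1..k}. parts_repeated i p = n i"
      then show "content p = n"
        using that by (intro PiE_ext[of _ "{1..k}" "\<lambda>_. UNIV"]) (auto simp: content_def)
    qed (auto simp: content_def)
    then show ?thesis by (auto simp: partitions_with_content_def F_def)
  qed
  \<comment> \<open>All partitions counted here have content \<open>n\<close>, so their number times
    the monomial is this sum.\<close>
  then have st: "fps_nth (series_term k n) N = (\<Sum>p | p \<in> F N \<and> content p = n. x (content p))"
    if "n \<in> ?E" for n N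
    using that by (simp add: series_term_eq counting_fps_def x_def mult.commute)
  \<comment> \<open>Convergence is checked for each power of q: finitely many terms contribute, and
    their coefficients add up to that of \<open>T\<close>.\<close>
  have "(partition_term k has_sum T) ?S"
  proof (rule has_sum_fpsI)
    fix N
    have sub: "{p\<in>?S. fps_nth (partition_term k p) N \<noteq> 0} \<subseteq> F N"
      using pt by (auto split: if_splits)
    then show "finite {p\<in>?S. fps_nth (partition_term k p) N \<noteq> 0}"
      by (rule finite_subset) (rule fin)
    have "fps_nth T N = (\<Sum>p\<in>F N. fps_nth (partition_term k p) N)"
      unfolding T_def by (simp, rule sum.cong) (auto simp: pt F_def)
    also have "\<dots> = (\<Sum>p | p \<in> ?S \<and> fps_nth (partition_term k p) N \<noteq> 0. fps_nth (partition_term k p) N)"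
      using sub by (intro sum.mono_neutral_right fin) (auto simp: F_def)
    finally show "fps_nth T N = \<dots>" .
  qed
  moreover have "(series_term k has_sum T) ?E"
  proof (rule has_sum_fpsI)
    fix N
    have img: "content ` F N \<subseteq> ?E"
      by (auto simp: content_def)
    have "fps_nth (series_term k n) N = 0" if "n \<in> ?E" "n \<notin> content ` F N" for n
    proof -
      have "{p. p \<in> F N \<and> content p = n} = {}" using that by auto
      then show ?thesis using st[OF that(1)] by (simp only: sum.empty)
    qed
    then have sub: "{n\<in>?E. fps_nth (series_term k n) N \<noteq> 0} \<subseteq> content ` F N"
      by blast
    then show "finite {n\<in>?E. fps_nth (series_term k n) N \<noteq> 0}"
      by (rule finite_subset) (simp add: fin)
    \<comment> \<open>The partitions in \<open>F N\<close> are grouped by content.\<close>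
    have "fps_nth T N = (\<Sum>n\<in>content ` F N. \<Sum>p | p \<in> F N \<and> content p = n. x (content p))"
      unfolding T_def by (simp add: sum.image_gen[OF fin, of _ N content])
    also have "\<dots> = (\<Sum>n\<in>content ` F N. fps_nth (series_term k n) N)"
      by (rule sum.cong) (use img st in auto)
    also have "\<dots> = (\<Sum>n | n \<in> ?E \<and> fps_nth (series_term k n) N \<noteq> 0. fps_nth (series_term k n) N)"
      using sub img by (intro sum.mono_neutral_right finite_imageI fin) auto
    finally show "fps_nth T N = \<dots>" .
  qed
  ultimately show ?thesis
    by (metis has_sum_imp_summable infsumI)
qed

end
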